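(* Let $\mathbb{K}$ be a field, $X$ an associative (not necessarily unital) $\mathbb{K}$-algebra and $\alpha$ a strong partial action of the multiplicative monoid $M=\{0,1\}$ on the algebra $X$ such that $\operatorname{dom}\alpha_0$ and $\operatorname{im}\alpha_0$ are ideals of $X$. Then $\alpha$ is globalizable (in the category of $\mathbb{K}$-algebras) if and only if $\ker\alpha_0$ is an ideal of $X$.
   Context: Let $M$ be a monoid with identity $e$. A strong partial action of $M$ on a set $X$ is a family $\alpha=\{\alpha_m:\operatorname{dom}\alpha_m\to X\}_{m\in M}$ of maps with $\operatorname{dom}\alpha_m\subseteq X$ such that: (1) $\operatorname{dom}\alpha_e=X$ and $\alpha_e=\mathrm{id}_X$; (2) $\alpha_m^{-1}(\operatorname{dom}\alpha_n)=\operatorname{dom}\alpha_{nm}\cap\operatorname{dom}\alpha_m$ for all $m,n\in M$; (3) $\alpha_n\circ\alpha_m=\alpha_{nm}$ on $\alpha_m^{-1}(\operatorname{dom}\alpha_n)$ for all $m,n\in M$. It is a global action if $\operatorname{dom}\alpha_m=X$ for all $m$. Algebras are associative and not necessarily unital. A strong partial action (global action) of $M$ on a $\mathbb{K}$-algebra $X$ is one on the underlying set such that each $\operatorname{dom}\alpha_m$ is a subalgebra of $X$ and each $\alpha_m$ is an algebra homomorphism. Write $\operatorname{im}\alpha_m=\alpha_m(\operatorname{dom}\alpha_m)$ and $\ker\alpha_0=\{x\in\operatorname{dom}\alpha_0:\alpha_0(x)=0\}$. Ideals are two-sided. If $\alpha$ is a strong partial action of $M$ on an algebra $X$ and $\beta$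 is a global action of $M$ on an algebra $Y$, a morphism $\iota:\alpha\to\beta$ is an algebra homomorphism $\iota:X\to Y$ with $\beta_m(\iota(x))=\iota(\alpha_m(x))$ for all $m\in M$, $x\in\operatorname{dom}\alpha_m$. A globalization of $\alpha$ is a pair $(\beta,\iota)$, with $\beta$ a global action of $M$ on a $\mathbb{K}$-algebra and $\iota:\alpha\to\beta$ a morphism, such that for all $x,y\in X$ and $m\in M$ with $\beta_m(\iota(x))=\iota(y)$ one has $x\in\operatorname{dom}\alpha_m$ and $\alpha_m(x)=y$. $\alpha$ is globalizable if it has a globalization. *)

theory Defs
  imports "HOL-Algebra.Module"
begin

section \<open>Algebras that need not be unital\<close>

text \<open>
  The record type for modules has a field for a multiplicative unit.  No axiom below
  mentions it, so for an algebra its value is irrelevant.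
\<close>

locale nonunital_algebra = module K A + K: field K for K (structure) and A (structure) +
  assumes mult_closed: "\<lbrakk>x \<in> carrier A; y \<in> carrier A\<rbrakk> \<Longrightarrow> x \<otimes>\<^bsub>A\<^esub> y \<in> carrier A"
    and mult_assoc: "\<lbrakk>x \<in> carrier A; y \<in> carrier A; z \<in> carrier A\<rbrakk> \<Longrightarrow>
      (x \<otimes>\<^bsub>A\<^esub> y) \<otimes>\<^bsub>A\<^esub> z = x \<otimes>\<^bsub>A\<^esub> (y \<otimes>\<^bsub>A\<^esub> z)"
    and mult_l_distr: "\<lbrakk>x \<in> carrier A; y \<in> carrier A; z \<in> carrier A\<rbrakk> \<Longrightarrow>
      (x \<oplus>\<^bsub>A\<^esub> y) \<otimes>\<^bsub>A\<^esub> z = x \<otimes>\<^bsub>A\<^esub> z \<oplus>\<^bsub>A\<^esub> y \<otimes>\<^bsub>A\<^esub> z"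
    and mult_r_distr: "\<lbrakk>x \<in> carrier A; y \<in> carrier A; z \<in> carrier A\<rbrakk> \<Longrightarrow>
      x \<otimes>\<^bsub>A\<^esub> (y \<oplus>\<^bsub>A\<^esub> z) = x \<otimes>\<^bsub>A\<^esub> y \<oplus>\<^bsub>A\<^esub> x \<otimes>\<^bsub>A\<^esub> z"
    and smult_mult_l: "\<lbrakk>c \<in> carrier K; x \<in> carrier A; y \<in> carrier A\<rbrakk> \<Longrightarrow>
      (c \<odot>\<^bsub>A\<^esub> x) \<otimes>\<^bsub>A\<^esub> y = c \<odot>\<^bsub>A\<^esub> (x \<otimes>\<^bsub>A\<^esub> y)"
    and smult_mult_r: "\<lbrakk>c \<in> carrier K; x \<in> carrier A; y \<in> carrier A\<rbrakk> \<Longrightarrow>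
      x \<otimes>\<^bsub>A\<^esub> (c \<odot>\<^bsub>A\<^esub> y) = c \<odot>\<^bsub>A\<^esub> (x \<otimes>\<^bsub>A\<^esub> y)"

definition nonunital_subalgebra ::
    "('k, 'r) ring_scheme \<Rightarrow> ('k, 'a, 'c) module_scheme \<Rightarrow> 'a set \<Rightarrow> bool" where
  "nonunital_subalgebra K A S \<longleftrightarrow>
     submodule S K A \<and> (\<forall>x\<in>S. \<forall>y\<in>S. x \<otimes>\<^bsub>A\<^esub> y \<in> S)"

definition algebra_ideal ::
    "('k, 'r) ring_scheme \<Rightarrow> ('k, 'a, 'c) module_scheme \<Rightarrow> 'a set \<Rightarrow> bool" where
  "algebra_ideal K A I \<longleftrightarrow>
     submodule I K A \<and> (\<forall>a\<in>carrier A. \<forall>x\<in>I. a \<otimes>\<^bsub>A\<^esub> x \<in> I \<and> x \<otimes>\<^bsub>A\<^esub> a \<in> I)"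

definition algebra_hom ::
    "('k, 'r) ring_scheme \<Rightarrow> ('k, 'a, 'c) module_scheme \<Rightarrow> ('k, 'b, 'd) module_scheme \<Rightarrow>
     ('a \<Rightarrow> 'b) set" where
  "algebra_hom K A B =
     {h. h \<in> hom (add_monoid A) (add_monoid B) \<and> h \<in> hom A B \<and>
         (\<forall>c\<in>carrier K. \<forall>x\<in>carrier A. h (c \<odot>\<^bsub>A\<^esub> x) = c \<odot>\<^bsub>B\<^esub> h x)}"


section \<open>Strong partial actions\<close>

text \<open>
  A family of partially defined maps is a function \<open>\<alpha> :: 'm \<Rightarrow> 'a \<Rightarrow> 'a option\<close>.
  The set \<open>dom (\<alpha> n \<circ>\<^sub>m \<alpha> m)\<close> is the preimage of \<open>dom (\<alpha> n)\<close> under \<open>\<alpha> m\<close>.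
\<close>

definition strong_partial_action ::
    "('m, 'n) monoid_scheme \<Rightarrow> 'a set \<Rightarrow> ('m \<Rightarrow> 'a \<rightharpoonup> 'a) \<Rightarrow> bool" where
  "strong_partial_action M S \<alpha> \<longleftrightarrow>
     (\<forall>m\<in>carrier M. dom (\<alpha> m) \<subseteq> S \<and> ran (\<alpha> m) \<subseteq> S) \<and>
     dom (\<alpha> \<one>\<^bsub>M\<^esub>) = S \<and> (\<forall>x\<in>S. \<alpha> \<one>\<^bsub>M\<^esub> x = Some x) \<and>
     (\<forall>m\<in>carrier M. \<forall>n\<in>carrier M.
        dom (\<alpha> n \<circ>\<^sub>m \<alpha> m) = dom (\<alpha> (n \<otimes>\<^bsub>M\<^esub> m)) \<inter> dom (\<alpha> m) \<and>
        (\<forall>x\<in>dom (\<alpha> n \<circ>\<^sub>m \<alpha> m). (\<alpha> n \<circ>\<^sub>m \<alpha> m) x = \<alpha> (n \<otimes>\<^bsub>M\<^esub> m) x))"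

definition algebra_partial_action ::
    "('m, 'n) monoid_scheme \<Rightarrow> ('k, 'r) ring_scheme \<Rightarrow> ('k, 'a, 'c) module_scheme \<Rightarrow>
     ('m \<Rightarrow> 'a \<rightharpoonup> 'a) \<Rightarrow> bool" where
  "algebra_partial_action M K A \<alpha> \<longleftrightarrow>
     strong_partial_action M (carrier A) \<alpha> \<and>
     (\<forall>m\<in>carrier M. nonunital_subalgebra K A (dom (\<alpha> m)) \<and>
        (\<lambda>x. the (\<alpha> m x)) \<in> algebra_hom K (A\<lparr>carrier := dom (\<alpha> m)\<rparr>) A)"

definition algebra_global_action ::
    "('m, 'n) monoid_scheme \<Rightarrow> ('k, 'r) ring_scheme \<Rightarrow> ('k, 'a, 'c) module_scheme \<Rightarrow>
     ('m \<Rightarrow> 'a \<rightharpoonup> 'a) \<Rightarrow> bool" where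
  "algebra_global_action M K A \<beta> \<longleftrightarrow>
     algebra_partial_action M K A \<beta> \<and> (\<forall>m\<in>carrier M. dom (\<beta> m) = carrier A)"

definition partial_kernel :: "('k, 'a, 'c) module_scheme \<Rightarrow> ('a \<rightharpoonup> 'a) \<Rightarrow> 'a set" where
  "partial_kernel A f = {x. f x = Some \<zero>\<^bsub>A\<^esub>}"


section \<open>Globalizations\<close>

definition action_morphism ::
    "('m, 'n) monoid_scheme \<Rightarrow> ('k, 'r) ring_scheme \<Rightarrow>
     ('k, 'a, 'c) module_scheme \<Rightarrow> ('m \<Rightarrow> 'a \<rightharpoonup> 'a) \<Rightarrow>
     ('k, 'b, 'd) module_scheme \<Rightarrow> ('m \<Rightarrow> 'b \<rightharpoonup> 'b) \<Rightarrow> ('a \<Rightarrow> 'b) \<Rightarrow> bool" where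
  "action_morphism M K X \<alpha> Y \<beta> \<iota> \<longleftrightarrow>
     \<iota> \<in> algebra_hom K X Y \<and>
     (\<forall>m\<in>carrier M. \<forall>x\<in>dom (\<alpha> m). \<beta> m (\<iota> x) = Some (\<iota> (the (\<alpha> m x))))"

definition globalization ::
    "('m, 'n) monoid_scheme \<Rightarrow> ('k, 'r) ring_scheme \<Rightarrow>
     ('k, 'a, 'c) module_scheme \<Rightarrow> ('m \<Rightarrow> 'a \<rightharpoonup> 'a) \<Rightarrow>
     ('k, 'b, 'd) module_scheme \<Rightarrow> ('m \<Rightarrow> 'b \<rightharpoonup> 'b) \<Rightarrow> ('a \<Rightarrow> 'b) \<Rightarrow> bool" where
  "globalization M K X \<alpha> Y \<beta> \<iota> \<longleftrightarrow>
     nonunital_algebra K Y \<and> algebra_global_action M K Y \<beta> \<and>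
     action_morphism M K X \<alpha> Y \<beta> \<iota> \<and>
     (\<forall>m\<in>carrier M. \<forall>x\<in>carrier X. \<forall>y\<in>carrier X.
        \<beta> m (\<iota> x) = Some (\<iota> y) \<longrightarrow> x \<in> dom (\<alpha> m) \<and> \<alpha> m x = Some y)"

text \<open>
  HOL cannot quantify existentially over the type of elements of \<open>Y\<close>, so \<open>globalizable\<close> fixes
  the type \<open>('m \<times> 'a) list list\<close>.  This loses nothing: in any globalization the elements
  \<open>\<beta> m (\<iota> x)\<close> generate an invariant subalgebra containing \<open>\<iota> X\<close>, whose elements are finite sums
  of finite products of the \<open>\<beta> m (\<iota> x)\<close>, so that it can be copied into this type.  The theorem
  \<open>globalization_imp_globalizable\<close> below proves this for a globalization on an arbitrary type.
\<close>

definition globalizable ::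
    "('m, 'n) monoid_scheme \<Rightarrow> ('k, 'r) ring_scheme \<Rightarrow> ('k, 'a, 'c) module_scheme \<Rightarrow>
     ('m \<Rightarrow> 'a \<rightharpoonup> 'a) \<Rightarrow> bool" where
  "globalizable M K X \<alpha> \<longleftrightarrow>
     (\<exists>(Y :: ('k, ('m \<times> 'a) list list) module) \<beta> \<iota>. globalization M K X \<alpha> Y \<beta> \<iota>)"

definition zero_one_monoid :: "nat monoid" where
  "zero_one_monoid = \<lparr>carrier = {0, 1}, mult = (*), one = 1\<rparr>"

lemma zero_one_monoid: "monoid zero_one_monoid"
  by (rule monoidI) (auto simp: zero_one_monoid_def)

section \<open>Independence of the type carrying a globalization\<close>

lemma nonunital_algebraI:
  assumes "field K" "abelian_group A"
    and sc: "\<And>c x. \<lbrakk>c \<in> carrier K; x \<in> carrier A\<rbrakk> \<Longrightarrow> c \<odot>\<^bsub>A\<^esub> x \<in> carrier A"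
    "\<And>a b x. \<lbrakk>a \<in> carrier K; b \<in> carrier K; x \<in> carrier A\<rbrakk> \<Longrightarrow>
      (a \<oplus>\<^bsub>K\<^esub> b) \<odot>\<^bsub>A\<^esub> x = a \<odot>\<^bsub>A\<^esub> x \<oplus>\<^bsub>A\<^esub> b \<odot>\<^bsub>A\<^esub> x"
    "\<And>a x y. \<lbrakk>a \<in> carrier K; x \<in> carrier A; y \<in> carrier A\<rbrakk> \<Longrightarrow>
      a \<odot>\<^bsub>A\<^esub> (x \<oplus>\<^bsub>A\<^esub> y) = a \<odot>\<^bsub>A\<^esub> x \<oplus>\<^bsub>A\<^esub> a \<odot>\<^bsub>A\<^esub> y"
    "\<And>a b x. \<lbrakk>a \<in> carrier K; b \<in> carrier K; x \<in> carrier A\<rbrakk> \<Longrightarrow>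
      (a \<otimes>\<^bsub>K\<^esub> b) \<odot>\<^bsub>A\<^esub> x = a \<odot>\<^bsub>A\<^esub> (b \<odot>\<^bsub>A\<^esub> x)"
    "\<And>x. x \<in> carrier A \<Longrightarrow> \<one>\<^bsub>K\<^esub> \<odot>\<^bsub>A\<^esub> x = x"
    and ax: "\<And>x y. \<lbrakk>x \<in> carrier A; y \<in> carrier A\<rbrakk> \<Longrightarrow> x \<otimes>\<^bsub>A\<^esub> y \<in> carrier A"
    "\<And>x y z. \<lbrakk>x \<in> carrier A; y \<in> carrier A; z \<in> carrier A\<rbrakk> \<Longrightarrow>
      (x \<otimes>\<^bsub>A\<^esub> y) \<otimes>\<^bsub>A\<^esub> z = x \<otimes>\<^bsub>A\<^esub> (y \<otimes>\<^bsub>A\<^esub> z)"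
    "\<And>x y z. \<lbrakk>x \<in> carrier A; y \<in> carrier A; z \<in> carrier A\<rbrakk> \<Longrightarrow>
      (x \<oplus>\<^bsub>A\<^esub> y) \<otimes>\<^bsub>A\<^esub> z = x \<otimes>\<^bsub>A\<^esub> z \<oplus>\<^bsub>A\<^esub> y \<otimes>\<^bsub>A\<^esub> z"
    "\<And>x y z. \<lbrakk>x \<in> carrier A; y \<in> carrier A; z \<in> carrier A\<rbrakk> \<Longrightarrow>
      x \<otimes>\<^bsub>A\<^esub> (y \<oplus>\<^bsub>A\<^esub> z) = x \<otimes>\<^bsub>A\<^esub> y \<oplus>\<^bsub>A\<^esub> x \<otimes>\<^bsub>A\<^esub> z"
    "\<And>c x y. \<lbrakk>c \<in> carrier K; x \<in> carrier A; y \<in> carrier A\<rbrakk> \<Longrightarrow>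
      (c \<odot>\<^bsub>A\<^esub> x) \<otimes>\<^bsub>A\<^esub> y = c \<odot>\<^bsub>A\<^esub> (x \<otimes>\<^bsub>A\<^esub> y)"
    "\<And>c x y. \<lbrakk>c \<in> carrier K; x \<in> carrier A; y \<in> carrier A\<rbrakk> \<Longrightarrow>
      x \<otimes>\<^bsub>A\<^esub> (c \<odot>\<^bsub>A\<^esub> y) = c \<odot>\<^bsub>A\<^esub> (x \<otimes>\<^bsub>A\<^esub> y)"
  shows "nonunital_algebra K A"
proof -
  have cr: "cring K" using field.is_ring assms(1) by (simp add: field_def domain_def)
  have "module K A" by (rule moduleI[OF cr assms(2) sc])
  then show ?thesis
    using assms(1) ax by (auto intro!: nonunital_algebra.intro nonunital_algebra_axioms.intro)
qed

lemma nonunital_subalgebraI: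
  assumes A: "nonunital_algebra K A"
    and S: "S \<subseteq> carrier A" "\<zero>\<^bsub>A\<^esub> \<in> S" "\<And>x y. \<lbrakk>x \<in> S; y \<in> S\<rbrakk> \<Longrightarrow> x \<oplus>\<^bsub>A\<^esub> y \<in> S"
      "\<And>c x. \<lbrakk>c \<in> carrier K; x \<in> S\<rbrakk> \<Longrightarrow> c \<odot>\<^bsub>A\<^esub> x \<in> S"
      "\<And>x y. \<lbrakk>x \<in> S; y \<in> S\<rbrakk> \<Longrightarrow> x \<otimes>\<^bsub>A\<^esub> y \<in> S"
  shows "nonunital_subalgebra K A S"
proof -
  interpret A: nonunital_algebra K A by (rule A)
  have neg: "\<ominus>\<^bsub>A\<^esub> x \<in> S" if "x \<in> S" for x
  proof -
    have "\<ominus>\<^bsub>A\<^esub> x = (\<ominus>\<^bsub>K\<^esub> \<one>\<^bsub>K\<^esub>) \<odot>\<^bsub>A\<^esub> x"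
      using A.smult_l_minus[of "\<one>\<^bsub>K\<^esub>" x] that S(1) by auto
    then show ?thesis using S(4)[OF _ that] by simp
  qed
  have "submodule S K A"
    by (rule A.submoduleI) (use S neg in auto)
  then show ?thesis using S(5) by (simp add: nonunital_subalgebra_def)
qed

lemma globalization_copy:
  fixes s :: "'b \<Rightarrow> 'e" and Y :: "('k, 'b, 'd) module_scheme"
  assumes glob: "globalization M K X \<alpha> Y \<beta> \<iota>"
    and M: "monoid M" and X: "nonunital_algebra K X"
    and \<alpha>: "algebra_partial_action M K X \<alpha>"
    and Z: "nonunital_subalgebra K Y Z"
    and \<iota>Z: "\<And>x. x \<in> carrier X \<Longrightarrow> \<iota> x \<in> Z"
    and \<beta>Z: "\<And>m z. \<lbrakk>m \<in> carrier M; z \<in> Z\<rbrakk> \<Longrightarrow> the (\<beta> m z) \<in> Z"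
    and rs: "\<And>z. z \<in> Z \<Longrightarrow> r (s z) = z"
  shows "\<exists>(Y' :: ('k, 'e) module) \<beta>' \<iota>'. globalization M K X \<alpha> Y' \<beta>' \<iota>'"
proof -
  interpret M: monoid M by (rule M)
  interpret X: nonunital_algebra K X by (rule X)
  have Y: "nonunital_algebra K Y" using glob by (simp add: globalization_def)
  interpret Y: nonunital_algebra K Y by (rule Y)
  have Zsub: "submodule Z K Y" and Zm: "\<And>x y. \<lbrakk>x \<in> Z; y \<in> Z\<rbrakk> \<Longrightarrow> x \<otimes>\<^bsub>Y\<^esub> y \<in> Z"
    using Z by (auto simp: nonunital_subalgebra_def)
  note ZE = Y.submoduleE[OF Zsub]
  have Zc: "\<And>z. z \<in> Z \<Longrightarrow> z \<in> carrier Y" using ZE(1) by auto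
  have Z0: "\<zero>\<^bsub>Y\<^esub> \<in> Z"
    using submodule.axioms(1)[OF Zsub] subgroup.one_closed by fastforce
  have Zn: "\<And>z. z \<in> Z \<Longrightarrow> \<ominus>\<^bsub>Y\<^esub> z \<in> Z" using ZE(3) by auto
  have Zs: "\<And>c z. \<lbrakk>c \<in> carrier K; z \<in> Z\<rbrakk> \<Longrightarrow> c \<odot>\<^bsub>Y\<^esub> z \<in> Z" using ZE(4) by auto
  have Za: "\<And>x y. \<lbrakk>x \<in> Z; y \<in> Z\<rbrakk> \<Longrightarrow> x \<oplus>\<^bsub>Y\<^esub> y \<in> Z" using ZE(5) by auto

  define b where "b m z = the (\<beta> m z)" for m z
  have spa: "strong_partial_action M (carrier Y) \<beta>"
    and dom\<beta>: "\<And>m. m \<in> carrier M \<Longrightarrow> dom (\<beta> m) = carrier Y"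
    and \<beta>hom: "\<And>m. m \<in> carrier M \<Longrightarrow> (\<lambda>x. the (\<beta> m x)) \<in> algebra_hom K (Y\<lparr>carrier := dom (\<beta> m)\<rparr>) Y"
    using glob by (auto simp: globalization_def algebra_global_action_def algebra_partial_action_def)
  have \<beta>b: "\<beta> m z = Some (b m z)" if "m \<in> carrier M" "z \<in> carrier Y" for m z
    using dom\<beta>[OF that(1)] that(2) by (metis b_def domIff option.collapse)
  have b1: "b \<one>\<^bsub>M\<^esub> z = z" if "z \<in> Z" for z
    using spa Zc[OF that] by (auto simp: strong_partial_action_def b_def)
  have bZ: "b m z \<in> Z" if "m \<in> carrier M" "z \<in> Z" for m z
    using \<beta>Z[OF that] by (simp add: b_def)
  have bb: "b n (b m z) = b (n \<otimes>\<^bsub>M\<^esub> m) z"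
    if "m \<in> carrier M" "n \<in> carrier M" "z \<in> Z" for m n z
  proof -
    have "(\<beta> n \<circ>\<^sub>m \<beta> m) z = Some (b n (b m z))"
      using \<beta>b[OF that(1) Zc[OF that(3)]] \<beta>b[OF that(2) Zc[OF bZ[OF that(1,3)]]]
      by (simp add: map_comp_def)
    moreover from this have "z \<in> dom (\<beta> n \<circ>\<^sub>m \<beta> m)" by blast
    then have "(\<beta> n \<circ>\<^sub>m \<beta> m) z = \<beta> (n \<otimes>\<^bsub>M\<^esub> m) z"
      using spa that unfolding strong_partial_action_def by blast
    ultimately show ?thesis by (simp add: b_def)
  qed
  have badd: "b m (x \<oplus>\<^bsub>Y\<^esub> y) = b m x \<oplus>\<^bsub>Y\<^esub> b m y"
    and bmul: "b m (x \<otimes>\<^bsub>Y\<^esub> y) = b m x \<otimes>\<^bsub>Y\<^esub> b m y"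
    if "m \<in> carrier M" "x \<in> Z" "y \<in> Z" for m x y
    using \<beta>hom[OF that(1)] Zc[OF that(2)] Zc[OF that(3)] dom\<beta>[OF that(1)]
    by (auto simp: algebra_hom_def hom_def b_def)
  have bsm: "b m (c \<odot>\<^bsub>Y\<^esub> x) = c \<odot>\<^bsub>Y\<^esub> b m x" if "m \<in> carrier M" "c \<in> carrier K" "x \<in> Z" for m c x
    using \<beta>hom[OF that(1)] Zc[OF that(3)] dom\<beta>[OF that(1)] that(2)
    by (auto simp: algebra_hom_def b_def)
  have \<iota>: "\<iota> \<in> algebra_hom K X Y"
    and mor: "\<And>m x. \<lbrakk>m \<in> carrier M; x \<in> dom (\<alpha> m)\<rbrakk> \<Longrightarrow> \<beta> m (\<iota> x) = Some (\<iota> (the (\<alpha> m x)))"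
    using glob by (auto simp: globalization_def action_morphism_def)
  have gl: "\<And>m x y. \<lbrakk>m \<in> carrier M; x \<in> carrier X; y \<in> carrier X; \<beta> m (\<iota> x) = Some (\<iota> y)\<rbrakk>
      \<Longrightarrow> x \<in> dom (\<alpha> m) \<and> \<alpha> m x = Some y"
    using glob by (auto simp: globalization_def)
  have s_inj: "s x = s y \<longleftrightarrow> x = y" if "x \<in> Z" "y \<in> Z" for x y
    using rs[OF that(1)] rs[OF that(2)] by metis

  define Y' :: "('k, 'e) module" where
    "Y' = \<lparr>carrier = s ` Z, mult = \<lambda>u v. s (r u \<otimes>\<^bsub>Y\<^esub> r v), one = s \<zero>\<^bsub>Y\<^esub>, zero = s \<zero>\<^bsub>Y\<^esub>,
           add = \<lambda>u v. s (r u \<oplus>\<^bsub>Y\<^esub> r v), smult = \<lambda>c u. s (c \<odot>\<^bsub>Y\<^esub> r u)\<rparr>"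
  have Y'_simps: "carrier Y' = s ` Z" "mult Y' = (\<lambda>u v. s (r u \<otimes>\<^bsub>Y\<^esub> r v))" "\<zero>\<^bsub>Y'\<^esub> = s \<zero>\<^bsub>Y\<^esub>"
    "add Y' = (\<lambda>u v. s (r u \<oplus>\<^bsub>Y\<^esub> r v))" "smult Y' = (\<lambda>c u. s (c \<odot>\<^bsub>Y\<^esub> r u))"
    by (simp_all add: Y'_def)
  define \<beta>' where "\<beta>' m u = (if u \<in> s ` Z then Some (s (b m (r u))) else None)" for m u
  have ab: "abelian_group Y'"
  proof (rule abelian_groupI)
    fix u assume "u \<in> carrier Y'"
    then obtain z where z: "z \<in> Z" "u = s z" by (auto simp: Y'_simps)
    show "\<exists>v\<in>carrier Y'. v \<oplus>\<^bsub>Y'\<^esub> u = \<zero>\<^bsub>Y'\<^esub>"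
      by (rule bexI[of _ "s (\<ominus>\<^bsub>Y\<^esub> z)"]) (use z in \<open>auto simp: Y'_simps rs Zn Zc Y.M.l_neg\<close>)
  qed (auto simp: Y'_simps rs Za Z0 Zc Y.M.a_assoc intro!: Y.M.a_comm arg_cong[of _ _ s])
  have Y'alg: "nonunital_algebra K Y'"
    by (rule nonunital_algebraI[OF nonunital_algebra.axioms(2)[OF Y] ab])
      (auto simp: Y'_simps rs Za Zs Zm Zc Y.smult_l_distr Y.smult_r_distr Y.smult_assoc1
         Y.mult_assoc Y.mult_l_distr Y.mult_r_distr Y.smult_mult_l Y.smult_mult_r)
  have dom\<beta>': "dom (\<beta>' m) = carrier Y'" for m
    by (auto simp: \<beta>'_def Y'_simps split: if_splits)
  have spa': "strong_partial_action M (carrier Y') \<beta>'"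
    unfolding strong_partial_action_def dom\<beta>'
  proof (intro conjI ballI)
    fix m assume m: "m \<in> carrier M"
    show "ran (\<beta>' m) \<subseteq> carrier Y'"
      using m by (auto simp: ran_def \<beta>'_def Y'_simps rs bZ split: if_splits)
    fix n assume n: "n \<in> carrier M"
    have *: "(\<beta>' n \<circ>\<^sub>m \<beta>' m) u = \<beta>' (n \<otimes>\<^bsub>M\<^esub> m) u" for u
      using m n by (auto simp: map_comp_def \<beta>'_def rs bZ bb s_inj)
    then have "(\<beta>' n \<circ>\<^sub>m \<beta>' m) = \<beta>' (n \<otimes>\<^bsub>M\<^esub> m)" by blast
    then show "dom (\<beta>' n \<circ>\<^sub>m \<beta>' m) = carrier Y' \<inter> carrier Y'" by (simp add: dom\<beta>')
    fix u show "(\<beta>' n \<circ>\<^sub>m \<beta>' m) u = \<beta>' (n \<otimes>\<^bsub>M\<^esub> m) u" by (rule *)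
  qed (auto simp: \<beta>'_def Y'_simps rs b1)
  interpret Y': nonunital_algebra K Y' by (rule Y'alg)
  have Y'sub: "nonunital_subalgebra K Y' (carrier Y')"
    by (rule nonunital_subalgebraI[OF Y'alg]) (auto intro: Y'.mult_closed)
  have hom': "(\<lambda>u. the (\<beta>' m u)) \<in> algebra_hom K (Y'\<lparr>carrier := carrier Y'\<rparr>) Y'"
    if "m \<in> carrier M" for m
    using that
    by (auto simp: algebra_hom_def hom_def \<beta>'_def Y'_simps rs bZ Za Zm Zs badd bmul bsm)
  have act': "algebra_global_action M K Y' \<beta>'"
    unfolding algebra_global_action_def algebra_partial_action_def dom\<beta>'
    using spa' Y'sub hom' by blast
  have \<iota>hom': "(\<lambda>x. s (\<iota> x)) \<in> algebra_hom K X Y'"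
    using \<iota> by (auto simp: algebra_hom_def hom_def Y'_simps rs \<iota>Z)
  have \<alpha>X: "dom (\<alpha> m) \<subseteq> carrier X \<and> ran (\<alpha> m) \<subseteq> carrier X" if "m \<in> carrier M" for m
    using \<alpha> that by (auto simp: algebra_partial_action_def strong_partial_action_def)
  have \<beta>'\<iota>: "\<beta>' m (s (\<iota> x)) = Some (s (b m (\<iota> x)))" if "x \<in> carrier X" for m x
    using \<iota>Z[OF that] by (auto simp: \<beta>'_def rs)
  have mor': "action_morphism M K X \<alpha> Y' \<beta>' (\<lambda>x. s (\<iota> x))"
    unfolding action_morphism_def
  proof (intro conjI ballI \<iota>hom')
    fix m x assume m: "m \<in> carrier M" and x: "x \<in> dom (\<alpha> m)"
    have "x \<in> carrier X" using \<alpha>X[OF m] x by blast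
    then show "\<beta>' m (s (\<iota> x)) = Some (s (\<iota> (the (\<alpha> m x))))"
      using mor[OF m x] by (simp add: \<beta>'\<iota> b_def)
  qed
  have gl': "x \<in> dom (\<alpha> m) \<and> \<alpha> m x = Some y"
    if "m \<in> carrier M" "x \<in> carrier X" "y \<in> carrier X" "\<beta>' m (s (\<iota> x)) = Some (s (\<iota> y))" for m x y
  proof -
    have "b m (\<iota> x) = \<iota> y"
      using that \<iota>Z bZ by (auto simp: \<beta>'\<iota> s_inj)
    then show ?thesis
      using gl[OF that(1-3)] \<beta>b[OF that(1) Zc[OF \<iota>Z[OF that(2)]]] by simp
  qed
  have "globalization M K X \<alpha> Y' \<beta>' (\<lambda>x. s (\<iota> x))"
    using Y'alg act' mor' gl' by (auto simp: globalization_def)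
  then show ?thesis by blast
qed

text \<open>
  An element of \<open>'p list list\<close> denotes the sum of the products of its entries; the empty word,
  which has no product without a unit, denotes zero.
\<close>

fun word_value :: "('k, 'b, 'd) module_scheme \<Rightarrow> ('p \<Rightarrow> 'b) \<Rightarrow> 'p list \<Rightarrow> 'b" where
  "word_value Y g [] = \<zero>\<^bsub>Y\<^esub>"
| "word_value Y g [p] = g p"
| "word_value Y g (p # q # w) = g p \<otimes>\<^bsub>Y\<^esub> word_value Y g (q # w)"

fun sum_value :: "('k, 'b, 'd) module_scheme \<Rightarrow> ('p \<Rightarrow> 'b) \<Rightarrow> 'p list list \<Rightarrow> 'b" where
  "sum_value Y g [] = \<zero>\<^bsub>Y\<^esub>"
| "sum_value Y g (w # ws) = word_value Y g w \<oplus>\<^bsub>Y\<^esub> sum_value Y g ws"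

context nonunital_algebra
begin

lemma mult_l_zero: "x \<in> carrier A \<Longrightarrow> \<zero>\<^bsub>A\<^esub> \<otimes>\<^bsub>A\<^esub> x = \<zero>\<^bsub>A\<^esub>"
  using smult_mult_l[of "\<zero>\<^bsub>K\<^esub>" "\<zero>\<^bsub>A\<^esub>" x] mult_closed[of "\<zero>\<^bsub>A\<^esub>" x] by simp

lemma mult_r_zero: "x \<in> carrier A \<Longrightarrow> x \<otimes>\<^bsub>A\<^esub> \<zero>\<^bsub>A\<^esub> = \<zero>\<^bsub>A\<^esub>"
  using smult_mult_r[of "\<zero>\<^bsub>K\<^esub>" x "\<zero>\<^bsub>A\<^esub>"] mult_closed[of x "\<zero>\<^bsub>A\<^esub>"] by simp

context
  fixes g :: "'p \<Rightarrow> 'c" and D :: "'p set"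
  assumes g: "\<And>p. p \<in> D \<Longrightarrow> g p \<in> carrier A"
begin

lemma word_value_closed: "w \<in> lists D \<Longrightarrow> word_value A g w \<in> carrier A"
proof (induction w)
  case (Cons p w)
  then show ?case by (cases w) (auto intro: mult_closed g)
qed simp

lemma sum_value_closed: "l \<in> lists (lists D) \<Longrightarrow> sum_value A g l \<in> carrier A"
  by (induction l) (auto intro: word_value_closed)

lemma sum_value_append:
  "l \<in> lists (lists D) \<Longrightarrow> l' \<in> lists (lists D) \<Longrightarrow>
     sum_value A g (l @ l') = sum_value A g l \<oplus>\<^bsub>A\<^esub> sum_value A g l'"
  by (induction l) (auto simp: word_value_closed sum_value_closed M.a_assoc)

lemma word_value_append:
  "v \<noteq> [] \<Longrightarrow> v \<in> lists D \<Longrightarrow> w \<in> lists D \<Longrightarrow> w \<noteq> [] \<Longrightarrow>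
     word_value A g (v @ w) = word_value A g v \<otimes>\<^bsub>A\<^esub> word_value A g w"
proof (induction v rule: list_nonempty_induct)
  case (single p)
  then show ?case by (cases w) auto
next
  case (cons p v)
  then obtain q u where v: "v = q # u" by (cases v) auto
  have "word_value A g (v @ w) = word_value A g v \<otimes>\<^bsub>A\<^esub> word_value A g w"
    using cons by auto
  then show ?case
    using cons.prems word_value_closed[of v] word_value_closed[of w] g[of p] v
    by (simp add: mult_assoc)
qed

lemma words_mult:
  assumes "v \<in> lists D" "w \<in> lists D"
  shows "\<exists>u\<in>lists D. word_value A g u = word_value A g v \<otimes>\<^bsub>A\<^esub> word_value A g w"
proof (cases "v = [] \<or> w = []")
  case True
  then show ?thesis
    using word_value_closed[OF assms(1)] word_value_closed[OF assms(2)]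
    by (intro bexI[of _ "[]"]) (auto simp: mult_l_zero mult_r_zero)
next
  case False
  then show ?thesis
    using word_value_append assms by (intro bexI[of _ "v @ w"]) auto
qed

lemma sum_value_induct [consumes 1, case_names zero word add]:
  assumes "z \<in> sum_value A g ` lists (lists D)"
    and "P \<zero>\<^bsub>A\<^esub>"
    and "\<And>w. w \<in> lists D \<Longrightarrow> P (word_value A g w)"
    and "\<And>x y. \<lbrakk>x \<in> carrier A; y \<in> carrier A; P x; P y\<rbrakk> \<Longrightarrow> P (x \<oplus>\<^bsub>A\<^esub> y)"
  shows "P z"
proof -
  have "P (sum_value A g l)" if "l \<in> lists (lists D)" for l
    using that
  proof (induction l)
    case (Cons w l)
    then have "w \<in> lists D" "l \<in> lists (lists D)" by auto
    then show ?case
      using Cons.IH assms(3,4) word_value_closed sum_value_closed by simp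
  qed (simp add: assms(2))
  then show ?thesis using assms(1) by blast
qed

lemma sum_value_add:
  assumes "x \<in> sum_value A g ` lists (lists D)" "y \<in> sum_value A g ` lists (lists D)"
  shows "x \<oplus>\<^bsub>A\<^esub> y \<in> sum_value A g ` lists (lists D)"
proof -
  obtain l l' where l: "l \<in> lists (lists D)" "l' \<in> lists (lists D)"
    "x = sum_value A g l" "y = sum_value A g l'" using assms by blast
  then have "x \<oplus>\<^bsub>A\<^esub> y = sum_value A g (l @ l')" by (simp add: sum_value_append)
  moreover have "l @ l' \<in> lists (lists D)" using l by auto
  ultimately show ?thesis by blast
qed

lemma sum_value_word:
  assumes "w \<in> lists D" shows "word_value A g w \<in> sum_value A g ` lists (lists D)"
proof -
  have "sum_value A g [w] = word_value A g w" using word_value_closed[OF assms] by simp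
  moreover have "[w] \<in> lists (lists D)" using assms by auto
  ultimately show ?thesis by (metis image_eqI)
qed

lemma sum_value_zero: "\<zero>\<^bsub>A\<^esub> \<in> sum_value A g ` lists (lists D)"
  by (rule image_eqI[of _ _ "[]"]) auto

lemma sum_value_subalgebra:
  assumes sm: "\<And>c p. \<lbrakk>c \<in> carrier K; p \<in> D\<rbrakk> \<Longrightarrow> \<exists>q\<in>D. g q = c \<odot>\<^bsub>A\<^esub> g p"
  shows "nonunital_subalgebra K A (sum_value A g ` lists (lists D))"
    (is "nonunital_subalgebra K A ?Z")
proof (rule nonunital_subalgebraI)
  show "nonunital_algebra K A" by unfold_locales
  show sub: "?Z \<subseteq> carrier A" using sum_value_closed by blast
  show "\<zero>\<^bsub>A\<^esub> \<in> ?Z" by (rule sum_value_zero)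
  show "x \<oplus>\<^bsub>A\<^esub> y \<in> ?Z" if "x \<in> ?Z" "y \<in> ?Z" for x y
    using that by (rule sum_value_add)
  have smw: "\<exists>u\<in>lists D. word_value A g u = c \<odot>\<^bsub>A\<^esub> word_value A g w"
    if c: "c \<in> carrier K" and w: "w \<in> lists D" for c w
  proof (cases w)
    case Nil
    then show ?thesis using c by (intro bexI[of _ "[]"]) auto
  next
    case (Cons p v)
    obtain q where q: "q \<in> D" "g q = c \<odot>\<^bsub>A\<^esub> g p" using sm[OF c, of p] w Cons by auto
    have "word_value A g (q # v) = c \<odot>\<^bsub>A\<^esub> word_value A g w"
      using q c w Cons g word_value_closed by (cases v) (auto simp: smult_mult_l)
    then show ?thesis using q(1) w Cons by (intro bexI[of _ "q # v"]) auto
  qed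
  show "c \<odot>\<^bsub>A\<^esub> x \<in> ?Z" if c: "c \<in> carrier K" and x: "x \<in> ?Z" for c x
    using x
  proof (induction rule: sum_value_induct)
    case zero
    then show ?case using c sum_value_zero by simp
  next
    case (word w)
    then show ?case using smw[OF c word] sum_value_word by metis
  next
    case (add x y)
    then show ?case using c by (simp add: smult_r_distr sum_value_add)
  qed
  show "x \<otimes>\<^bsub>A\<^esub> y \<in> ?Z" if x: "x \<in> ?Z" and y: "y \<in> ?Z" for x y
    using x
  proof (induction rule: sum_value_induct)
    case zero
    have "y \<in> carrier A" using sub y by blast
    then show ?case using sum_value_zero by (simp add: mult_l_zero)
  next
    case (word v)
    have vc: "word_value A g v \<in> carrier A" using word by (rule word_value_closed)
    show ?case using y
    proof (induction rule: sum_value_induct)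
      case zero
      then show ?case using vc sum_value_zero by (simp add: mult_r_zero)
    next
      case (word w)
      then show ?case using words_mult[OF \<open>v \<in> lists D\<close> word] sum_value_word by metis
    next
      case (add x y)
      then show ?case using vc by (simp add: mult_r_distr sum_value_add)
    qed
  next
    case (add x1 x2)
    have "y \<in> carrier A" using sub y by blast
    then show ?case using add by (simp add: mult_l_distr sum_value_add)
  qed
qed

lemma sum_value_invariant:
  assumes f: "f \<in> algebra_hom K A A"
    and fg: "\<And>p. p \<in> D \<Longrightarrow> \<exists>q\<in>D. g q = f (g p)"
    and z: "z \<in> sum_value A g ` lists (lists D)"
  shows "f z \<in> sum_value A g ` lists (lists D)"
proof -
  have fa: "f (x \<oplus>\<^bsub>A\<^esub> y) = f x \<oplus>\<^bsub>A\<^esub> f y" and fm: "f (x \<otimes>\<^bsub>A\<^esub> y) = f x \<otimes>\<^bsub>A\<^esub> f y"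
    and fc: "f x \<in> carrier A"
    if "x \<in> carrier A" "y \<in> carrier A" for x y
    using f that by (auto simp: algebra_hom_def hom_def)
  have "f (\<zero>\<^bsub>K\<^esub> \<odot>\<^bsub>A\<^esub> \<zero>\<^bsub>A\<^esub>) = \<zero>\<^bsub>K\<^esub> \<odot>\<^bsub>A\<^esub> f \<zero>\<^bsub>A\<^esub>"
    using f R.zero_closed M.zero_closed unfolding algebra_hom_def by blast
  then have f0: "f \<zero>\<^bsub>A\<^esub> = \<zero>\<^bsub>A\<^esub>" using fc[OF M.zero_closed M.zero_closed] by simp
  have fw: "\<exists>u\<in>lists D. word_value A g u = f (word_value A g w)" if "w \<in> lists D" for w
    using that
  proof (induction w)
    case Nil
    then show ?case by (intro bexI[of _ "[]"]) (auto simp: f0)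
  next
    case (Cons p w)
    then have p: "p \<in> D" and w: "w \<in> lists D" by auto
    obtain q where q: "q \<in> D" "g q = f (g p)" using fg[OF p] by blast
    show ?case
    proof (cases "w = []")
      case True
      then show ?thesis using q by (intro bexI[of _ "[q]"]) auto
    next
      case False
      then have "word_value A g (p # w) = g p \<otimes>\<^bsub>A\<^esub> word_value A g w" by (cases w) auto
      then have "f (word_value A g (p # w)) = g q \<otimes>\<^bsub>A\<^esub> f (word_value A g w)"
        using fm[OF g[OF p] word_value_closed[OF w]] q by simp
      moreover obtain u where u: "u \<in> lists D" "word_value A g u = f (word_value A g w)"
        using Cons.IH by blast
      ultimately show ?thesis using words_mult[of "[q]" u] q(1) by auto
    qed
  qed
  show ?thesis using z
  proof (induction rule: sum_value_induct)
    case zero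
    then show ?case by (simp add: f0 sum_value_zero)
  next
    case (word w)
    then show ?case using fw[OF word] sum_value_word by metis
  next
    case (add x y)
    then show ?case by (simp add: fa sum_value_add)
  qed
qed

end

end

theorem globalization_imp_globalizable:
  fixes Y :: "('k, 'b, 'd) module_scheme"
  assumes M: "monoid M" and X: "nonunital_algebra K X"
    and \<alpha>: "algebra_partial_action M K X \<alpha>"
    and glob: "globalization M K X \<alpha> Y \<beta> \<iota>"
  shows "globalizable M K X \<alpha>"
proof -
  interpret M: monoid M by (rule M)
  interpret X: nonunital_algebra K X by (rule X)
  have Y: "nonunital_algebra K Y" using glob by (simp add: globalization_def)
  interpret Y: nonunital_algebra K Y by (rule Y)
  have spa: "strong_partial_action M (carrier Y) \<beta>"
    and dom\<beta>: "\<And>m. m \<in> carrier M \<Longrightarrow> dom (\<beta> m) = carrier Y"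
    and \<beta>hom: "\<And>m. m \<in> carrier M \<Longrightarrow> (\<lambda>x. the (\<beta> m x)) \<in> algebra_hom K (Y\<lparr>carrier := dom (\<beta> m)\<rparr>) Y"
    and \<iota>: "\<iota> \<in> algebra_hom K X Y"
    using glob by (auto simp: globalization_def algebra_global_action_def
        algebra_partial_action_def action_morphism_def)
  define b where "b m z = the (\<beta> m z)" for m z
  have bhom: "b m \<in> algebra_hom K Y Y" if "m \<in> carrier M" for m
    using \<beta>hom[OF that] dom\<beta>[OF that] by (simp add: b_def[abs_def])
  have bc: "b m z \<in> carrier Y" if "m \<in> carrier M" "z \<in> carrier Y" for m z
    using bhom[OF that(1)] that(2) by (auto simp: algebra_hom_def hom_def)
  have \<beta>b: "\<beta> m z = Some (b m z)" if "m \<in> carrier M" "z \<in> carrier Y" for m z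
    using dom\<beta>[OF that(1)] that(2) by (metis b_def domIff option.collapse)
  have b1: "b \<one>\<^bsub>M\<^esub> z = z" if "z \<in> carrier Y" for z
    using spa that by (auto simp: strong_partial_action_def b_def)
  have bb: "b n (b m z) = b (n \<otimes>\<^bsub>M\<^esub> m) z"
    if "m \<in> carrier M" "n \<in> carrier M" "z \<in> carrier Y" for m n z
  proof -
    have "(\<beta> n \<circ>\<^sub>m \<beta> m) z = Some (b n (b m z))"
      using \<beta>b[OF that(1,3)] \<beta>b[OF that(2) bc[OF that(1,3)]] by (simp add: map_comp_def)
    moreover from this have "z \<in> dom (\<beta> n \<circ>\<^sub>m \<beta> m)" by blast
    then have "(\<beta> n \<circ>\<^sub>m \<beta> m) z = \<beta> (n \<otimes>\<^bsub>M\<^esub> m) z"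
      using spa that unfolding strong_partial_action_def by blast
    ultimately show ?thesis by (simp add: b_def)
  qed
  have \<iota>c: "\<iota> x \<in> carrier Y" if "x \<in> carrier X" for x
    using \<iota> that by (auto simp: algebra_hom_def hom_def)

  define D where "D = carrier M \<times> carrier X"
  define g where "g p = b (fst p) (\<iota> (snd p))" for p
  define Z where "Z = sum_value Y g ` lists (lists D)"
  define s where "s = inv_into (lists (lists D)) (sum_value Y g)"
  have g: "g p \<in> carrier Y" if "p \<in> D" for p
    using that by (auto simp: D_def g_def intro!: bc \<iota>c)
  have sm: "\<exists>q\<in>D. g q = c \<odot>\<^bsub>Y\<^esub> g p" if c: "c \<in> carrier K" and p: "p \<in> D" for c p
  proof (rule bexI[of _ "(fst p, c \<odot>\<^bsub>X\<^esub> snd p)"])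
    have m: "fst p \<in> carrier M" and x: "snd p \<in> carrier X" using p by (auto simp: D_def)
    have "\<iota> (c \<odot>\<^bsub>X\<^esub> snd p) = c \<odot>\<^bsub>Y\<^esub> \<iota> (snd p)" using \<iota> c x by (auto simp: algebra_hom_def)
    then show "g (fst p, c \<odot>\<^bsub>X\<^esub> snd p) = c \<odot>\<^bsub>Y\<^esub> g p"
      using bhom[OF m] \<iota>c[OF x] c by (auto simp: g_def algebra_hom_def)
    show "(fst p, c \<odot>\<^bsub>X\<^esub> snd p) \<in> D" using m x c by (simp add: D_def)
  qed
  have inv: "\<exists>q\<in>D. g q = b m (g p)" if m: "m \<in> carrier M" and p: "p \<in> D" for m p
    by (rule bexI[of _ "(m \<otimes>\<^bsub>M\<^esub> fst p, snd p)"])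
      (use m p in \<open>auto simp: g_def D_def bb \<iota>c\<close>)
  have subalg: "nonunital_subalgebra K Y Z"
    unfolding Z_def using g sm by (rule Y.sum_value_subalgebra)
  have \<iota>Z: "\<iota> x \<in> Z" if "x \<in> carrier X" for x
  proof -
    have "[(\<one>\<^bsub>M\<^esub>, x)] \<in> lists D" using that by (auto simp: D_def)
    from Y.sum_value_word[where g = g and D = D, OF g this]
    show ?thesis using b1[OF \<iota>c[OF that]] by (simp add: Z_def g_def)
  qed
  have bZ: "the (\<beta> m z) \<in> Z" if m: "m \<in> carrier M" and z: "z \<in> Z" for m z
    using Y.sum_value_invariant[where g = g and D = D, OF g bhom[OF m] inv[OF m]] z
    by (simp add: Z_def b_def)
  have rs: "sum_value Y g (s z) = z" if "z \<in> Z" for z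
    using that unfolding Z_def s_def by (rule f_inv_into_f)
  show ?thesis
    unfolding globalizable_def
    by (rule globalization_copy[where s = s, OF glob M X \<alpha> subalg \<iota>Z bZ rs])
qed

end

theory Submission
  imports Defs "HOL-Algebra.QuotRing"
begin

text \<open>
  Put \<open>N = ker \<alpha>\<^sub>0\<close> and \<open>I = im \<alpha>\<^sub>0\<close>.  The map \<open>\<alpha>\<^sub>0\<close> is an idempotent endomorphism of its domain
  \<open>D\<close>, so \<open>D\<close> is the direct sum of \<open>N\<close> and \<open>I\<close>.  In a globalization \<open>\<beta>\<^sub>0\<close> is multiplicative, hence
  \<open>\<beta>\<^sub>0 (\<iota> (x n)) = 0\<close> for \<open>n\<close> in \<open>N\<close> and arbitrary \<open>x\<close>, and the globalization property puts \<open>x n\<close>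
  into \<open>N\<close>.  Conversely, if \<open>N\<close> is an ideal, then the diagonal map from \<open>X\<close> to \<open>X/N \<times> X/I\<close>
  together with the projection \<open>(P, Q) \<mapsto> (P, 0)\<close> is a globalization: \<open>(x + N, 0)\<close> is
  the image of \<open>y\<close> precisely when \<open>y \<in> I\<close> and \<open>x - y \<in> N\<close>, that is, when \<open>x \<in> D\<close> and
  \<open>\<alpha>\<^sub>0 x = y\<close>.
\<close>

section \<open>Homomorphisms and ideals of non-unital algebras\<close>

lemma algebra_homD:
  assumes "h \<in> algebra_hom K A B"
  shows "x \<in> carrier A \<Longrightarrow> h x \<in> carrier B"
    and "\<lbrakk>x \<in> carrier A; y \<in> carrier A\<rbrakk> \<Longrightarrow> h (x \<oplus>\<^bsub>A\<^esub> y) = h x \<oplus>\<^bsub>B\<^esub> h y"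
    and "\<lbrakk>x \<in> carrier A; y \<in> carrier A\<rbrakk> \<Longrightarrow> h (x \<otimes>\<^bsub>A\<^esub> y) = h x \<otimes>\<^bsub>B\<^esub> h y"
    and "\<lbrakk>c \<in> carrier K; x \<in> carrier A\<rbrakk> \<Longrightarrow> h (c \<odot>\<^bsub>A\<^esub> x) = c \<odot>\<^bsub>B\<^esub> h x"
  using assms by (auto simp: algebra_hom_def hom_def)

lemma algebra_homI:
  assumes "\<And>x. x \<in> carrier A \<Longrightarrow> h x \<in> carrier B"
    and "\<And>x y. \<lbrakk>x \<in> carrier A; y \<in> carrier A\<rbrakk> \<Longrightarrow> h (x \<oplus>\<^bsub>A\<^esub> y) = h x \<oplus>\<^bsub>B\<^esub> h y"
    and "\<And>x y. \<lbrakk>x \<in> carrier A; y \<in> carrier A\<rbrakk> \<Longrightarrow> h (x \<otimes>\<^bsub>A\<^esub> y) = h x \<otimes>\<^bsub>B\<^esub> h y"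
    and "\<And>c x. \<lbrakk>c \<in> carrier K; x \<in> carrier A\<rbrakk> \<Longrightarrow> h (c \<odot>\<^bsub>A\<^esub> x) = c \<odot>\<^bsub>B\<^esub> h x"
  shows "h \<in> algebra_hom K A B"
  using assms by (auto simp: algebra_hom_def hom_def)

text \<open>Zero is the zero scalar times itself, and \<open>h\<close> commutes with
  scalars.\<close>

lemma algebra_hom_zero:
  assumes A: "nonunital_algebra K A" and B: "nonunital_algebra K B" and h: "h \<in> algebra_hom K A B"
  shows "h \<zero>\<^bsub>A\<^esub> = \<zero>\<^bsub>B\<^esub>"
proof -
  interpret A: nonunital_algebra K A by (rule A)
  interpret B: nonunital_algebra K B by (rule B)
  have "h (\<zero>\<^bsub>K\<^esub> \<odot>\<^bsub>A\<^esub> \<zero>\<^bsub>A\<^esub>) = \<zero>\<^bsub>K\<^esub> \<odot>\<^bsub>B\<^esub> h \<zero>\<^bsub>A\<^esub>"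
    by (rule algebra_homD(4)[OF h]) auto
  then show ?thesis using algebra_homD(1)[OF h A.zero_closed] by simp
qed

text \<open>Negatives come from the scalar -1, through \<open>nonunital_subalgebraI\<close>.\<close>

lemma algebra_idealI:
  assumes A: "nonunital_algebra K A"
    and S: "S \<subseteq> carrier A" "\<zero>\<^bsub>A\<^esub> \<in> S" "\<And>x y. \<lbrakk>x \<in> S; y \<in> S\<rbrakk> \<Longrightarrow> x \<oplus>\<^bsub>A\<^esub> y \<in> S"
      "\<And>c x. \<lbrakk>c \<in> carrier K; x \<in> S\<rbrakk> \<Longrightarrow> c \<odot>\<^bsub>A\<^esub> x \<in> S"
      "\<And>a x. \<lbrakk>a \<in> carrier A; x \<in> S\<rbrakk> \<Longrightarrow> a \<otimes>\<^bsub>A\<^esub> x \<in> S"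
      "\<And>a x. \<lbrakk>a \<in> carrier A; x \<in> S\<rbrakk> \<Longrightarrow> x \<otimes>\<^bsub>A\<^esub> a \<in> S"
  shows "algebra_ideal K A S"
proof -
  have "nonunital_subalgebra K A S"
    by (rule nonunital_subalgebraI[OF A]) (use S in auto)
  then show ?thesis using S(5,6) by (simp add: algebra_ideal_def nonunital_subalgebra_def)
qed

text \<open>The axioms are identities, so they pass to a surjective image; this spares a check on
  cosets. As \<open>B\<close> is not yet known to be an algebra, preservation of zero cannot come
  from \<open>algebra_hom_zero\<close> and has to be assumed.\<close>

lemma nonunital_algebra_image:
  assumes A: "nonunital_algebra K A" and h: "h \<in> algebra_hom K A B"
    and surj: "carrier B = h ` carrier A" and zero: "h \<zero>\<^bsub>A\<^esub> = \<zero>\<^bsub>B\<^esub>"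
  shows "nonunital_algebra K B"
proof -
  interpret A: nonunital_algebra K A by (rule A)
  \<comment> \<open>Reversed, these equations pull the operations of \<open>B\<close> inside
    \<open>h\<close>, where the axioms of \<open>A\<close> apply.\<close>
  note hs = algebra_homD(2-4)[OF h, symmetric] zero[symmetric]
  have ab: "abelian_group B"
  proof (rule abelian_groupI)
    fix x assume "x \<in> carrier B"
    then obtain u where u: "u \<in> carrier A" "x = h u" using surj by blast
    then have "h (\<ominus>\<^bsub>A\<^esub> u) \<oplus>\<^bsub>B\<^esub> x = \<zero>\<^bsub>B\<^esub>" by (simp add: hs A.l_neg)
    then show "\<exists>y\<in>carrier B. y \<oplus>\<^bsub>B\<^esub> x = \<zero>\<^bsub>B\<^esub>" using u surj by auto
  qed (auto simp: surj hs A.a_ac)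
  show ?thesis
    by (rule nonunital_algebraI[OF A.K.field_axioms ab])
      (auto simp: surj hs A.smult_l_distr A.smult_r_distr A.smult_assoc1 A.mult_closed A.mult_assoc
        A.mult_l_distr A.mult_r_distr A.smult_mult_l A.smult_mult_r)
qed

section \<open>Quotients by two-sided ideals\<close>

text \<open>Scalar multiplication is a union over all representatives, in the style of
  \<open>rcoset_mult\<close>, so that no representative has to be chosen; for an ideal all sets in
  the union coincide.\<close>

definition quotient_algebra ::
    "('k, 'a, 'c) module_scheme \<Rightarrow> 'a set \<Rightarrow> ('k, 'a set) module" where
  "quotient_algebra A S =
     \<lparr>carrier = a_rcosets\<^bsub>A\<^esub> S, mult = rcoset_mult A S, one = S +>\<^bsub>A\<^esub> \<one>\<^bsub>A\<^esub>,
      zero = S, add = set_add A, smult = (\<lambda>c P. \<Union>p\<in>P. S +>\<^bsub>A\<^esub> (c \<odot>\<^bsub>A\<^esub> p))\<rparr>"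

context nonunital_algebra
begin

lemma zero_mult:
  assumes "x \<in> carrier A"
  shows "\<zero>\<^bsub>A\<^esub> \<otimes>\<^bsub>A\<^esub> x = \<zero>\<^bsub>A\<^esub>" and "x \<otimes>\<^bsub>A\<^esub> \<zero>\<^bsub>A\<^esub> = \<zero>\<^bsub>A\<^esub>"
  using smult_mult_l[of "\<zero>\<^bsub>K\<^esub>" "\<zero>\<^bsub>A\<^esub>" x] smult_mult_r[of "\<zero>\<^bsub>K\<^esub>" x "\<zero>\<^bsub>A\<^esub>"] assms
  by (simp_all add: mult_closed)

text \<open>Makes the theory of additive cosets available for algebra ideals.\<close>

lemma algebra_ideal_abelian_subgroup:
  assumes "algebra_ideal K A S"
  shows "abelian_subgroup S A"
proof -
  have "subgroup S (add_monoid A)"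
    using assms by (simp add: algebra_ideal_def submodule_def)
  then show ?thesis
    by (intro abelian_subgroupI3 additive_subgroup.intro M.abelian_group_axioms)
qed

context
  fixes S
  assumes S: "algebra_ideal K A S"
begin

interpretation S: abelian_subgroup S A
  using S by (rule algebra_ideal_abelian_subgroup)

lemma coset_eq_iff:
  assumes "x \<in> carrier A" "y \<in> carrier A"
  shows "S +>\<^bsub>A\<^esub> x = S +>\<^bsub>A\<^esub> y \<longleftrightarrow> x \<ominus>\<^bsub>A\<^esub> y \<in> S"
proof -
  have "S +>\<^bsub>A\<^esub> x = S +>\<^bsub>A\<^esub> y \<longleftrightarrow> x \<in> S +>\<^bsub>A\<^esub> y"
    using S.a_repr_independence' S.a_rcos_self assms by blast
  then show ?thesis using S.a_rcos_module[of y x] assms by (simp add: a_minus_def)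
qed

lemma coset_memD:
  assumes "x \<in> carrier A" "p \<in> S +>\<^bsub>A\<^esub> x"
  shows "p \<in> carrier A" and "\<exists>s\<in>S. p = s \<oplus>\<^bsub>A\<^esub> x"
  using assms S.a_subset by (auto simp: a_r_coset_def')

lemma coset_add_left:
  assumes "x \<in> carrier A" "s \<in> S"
  shows "S +>\<^bsub>A\<^esub> (s \<oplus>\<^bsub>A\<^esub> x) = S +>\<^bsub>A\<^esub> x"
  using S.a_repr_independence'[of "s \<oplus>\<^bsub>A\<^esub> x" x] assms by (auto simp: a_r_coset_def')

text \<open>For \<open>s\<close> in \<open>S\<close>, c(s + x) = cs + cx with cs in
  \<open>S\<close>, so the coset does not depend on the representative.\<close>

lemma coset_smult:
  assumes x: "x \<in> carrier A" and c: "c \<in> carrier K"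
  shows "(\<Union>p\<in>S +>\<^bsub>A\<^esub> x. S +>\<^bsub>A\<^esub> (c \<odot>\<^bsub>A\<^esub> p)) = S +>\<^bsub>A\<^esub> (c \<odot>\<^bsub>A\<^esub> x)"
proof -
  have "S +>\<^bsub>A\<^esub> (c \<odot>\<^bsub>A\<^esub> p) = S +>\<^bsub>A\<^esub> (c \<odot>\<^bsub>A\<^esub> x)" if p: "p \<in> S +>\<^bsub>A\<^esub> x" for p
  proof -
    obtain s where s: "s \<in> S" "p = s \<oplus>\<^bsub>A\<^esub> x" using coset_memD(2)[OF x p] by blast
    moreover have "c \<odot>\<^bsub>A\<^esub> s \<in> S"
      using S s(1) c submoduleE(4) by (simp add: algebra_ideal_def)
    moreover have "s \<in> carrier A" using s(1) S.a_subset by blast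
    ultimately show ?thesis using x c by (simp add: smult_r_distr coset_add_left)
  qed
  \<comment> \<open>The coset contains \<open>x\<close>, so the union of equal sets is not
    empty.\<close>
  then show ?thesis using S.a_rcos_self[OF x] by blast
qed

lemma coset_mult:
  assumes x: "x \<in> carrier A" and y: "y \<in> carrier A"
  shows "rcoset_mult A S (S +>\<^bsub>A\<^esub> x) (S +>\<^bsub>A\<^esub> y) = S +>\<^bsub>A\<^esub> (x \<otimes>\<^bsub>A\<^esub> y)"
proof -
  have "S +>\<^bsub>A\<^esub> (p \<otimes>\<^bsub>A\<^esub> q) = S +>\<^bsub>A\<^esub> (x \<otimes>\<^bsub>A\<^esub> y)"
    if p: "p \<in> S +>\<^bsub>A\<^esub> x" and q: "q \<in> S +>\<^bsub>A\<^esub> y" for p q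
  proof -
    obtain s where s: "s \<in> S" "p = s \<oplus>\<^bsub>A\<^esub> x" using coset_memD(2)[OF x p] by blast
    obtain t where t: "t \<in> S" "q = t \<oplus>\<^bsub>A\<^esub> y" using coset_memD(2)[OF y q] by blast
    have sc: "s \<in> carrier A" and tc: "t \<in> carrier A" using s(1) t(1) S.a_subset by auto
    \<comment> \<open>Two-sidedness enters here: in pq = sq + xt + xy the term sq needs absorption
      on the right and xt on the left.\<close>
    have "s \<otimes>\<^bsub>A\<^esub> q \<in> S" "x \<otimes>\<^bsub>A\<^esub> t \<in> S"
      using S s(1) t(1) x coset_memD(1)[OF y q] by (auto simp: algebra_ideal_def)
    moreover have "p \<otimes>\<^bsub>A\<^esub> q = s \<otimes>\<^bsub>A\<^esub> q \<oplus>\<^bsub>A\<^esub> (x \<otimes>\<^bsub>A\<^esub> t \<oplus>\<^bsub>A\<^esub> x \<otimes>\<^bsub>A\<^esub> y)"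
      using s(2) t(2) sc tc x y by (simp add: mult_l_distr mult_r_distr mult_closed M.a_ac)
    ultimately show ?thesis using x y tc by (simp add: coset_add_left mult_closed)
  qed
  then show ?thesis
    using S.a_rcos_self[OF x] S.a_rcos_self[OF y] unfolding rcoset_mult_def by blast
qed

lemma coset_algebra_hom: "(\<lambda>x. S +>\<^bsub>A\<^esub> x) \<in> algebra_hom K A (quotient_algebra A S)"
  by (rule algebra_homI)
    (auto simp: quotient_algebra_def coset_mult coset_smult S.a_rcos_sum
      a_rcosetsI[OF S.a_subset])

text \<open>The axioms descend along the coset map, which is onto and sends zero to
  \<open>S\<close>.\<close>

lemma nonunital_algebra_quotient: "nonunital_algebra K (quotient_algebra A S)"
proof (rule nonunital_algebra_image[OF _ coset_algebra_hom])
  show "nonunital_algebra K A" by unfold_locales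
  show "carrier (quotient_algebra A S) = (\<lambda>x. S +>\<^bsub>A\<^esub> x) ` carrier A"
    by (auto simp: quotient_algebra_def A_RCOSETS_def')
  show "S +>\<^bsub>A\<^esub> \<zero>\<^bsub>A\<^esub> = \<zero>\<^bsub>quotient_algebra A S\<^esub>"
    using S.a_subset by (simp add: quotient_algebra_def)
qed

lemma coset_eq_zero_iff:
  assumes "x \<in> carrier A"
  shows "S +>\<^bsub>A\<^esub> x = \<zero>\<^bsub>quotient_algebra A S\<^esub> \<longleftrightarrow> x \<in> S"
  using S.a_rcos_self[OF assms] S.a_rcos_const by (auto simp: quotient_algebra_def)

end

end

section \<open>Products of algebras\<close>

definition product_algebra ::
    "('k, 'a, 'c) module_scheme \<Rightarrow> ('k, 'b, 'd) module_scheme \<Rightarrow> ('k, 'a \<times> 'b) module" where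
  "product_algebra A B =
     \<lparr>carrier = carrier A \<times> carrier B,
      mult = (\<lambda>p q. (fst p \<otimes>\<^bsub>A\<^esub> fst q, snd p \<otimes>\<^bsub>B\<^esub> snd q)), one = (\<one>\<^bsub>A\<^esub>, \<one>\<^bsub>B\<^esub>),
      zero = (\<zero>\<^bsub>A\<^esub>, \<zero>\<^bsub>B\<^esub>), add = (\<lambda>p q. (fst p \<oplus>\<^bsub>A\<^esub> fst q, snd p \<oplus>\<^bsub>B\<^esub> snd q)),
      smult = (\<lambda>c p. (c \<odot>\<^bsub>A\<^esub> fst p, c \<odot>\<^bsub>B\<^esub> snd p))\<rparr>"

lemma nonunital_algebra_product:
  assumes A: "nonunital_algebra K A" and B: "nonunital_algebra K B"
  shows "nonunital_algebra K (product_algebra A B)"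
proof -
  interpret A: nonunital_algebra K A by (rule A)
  interpret B: nonunital_algebra K B by (rule B)
  have ab: "abelian_group (product_algebra A B)"
  proof (rule abelian_groupI)
    fix x assume "x \<in> carrier (product_algebra A B)"
    then show "\<exists>y\<in>carrier (product_algebra A B).
        y \<oplus>\<^bsub>product_algebra A B\<^esub> x = \<zero>\<^bsub>product_algebra A B\<^esub>"
      by (intro bexI[of _ "(\<ominus>\<^bsub>A\<^esub> fst x, \<ominus>\<^bsub>B\<^esub> snd x)"])
        (auto simp: product_algebra_def A.l_neg B.l_neg)
  qed (auto simp: product_algebra_def A.a_ac B.a_ac)
  show ?thesis
    by (rule nonunital_algebraI[OF A.K.field_axioms ab])
      (auto simp: product_algebra_def A.smult_l_distr A.smult_r_distr A.smult_assoc1 A.mult_closed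
        A.mult_assoc A.mult_l_distr A.mult_r_distr A.smult_mult_l A.smult_mult_r
        B.smult_l_distr B.smult_r_distr B.smult_assoc1 B.mult_closed
        B.mult_assoc B.mult_l_distr B.mult_r_distr B.smult_mult_l B.smult_mult_r)
qed

section \<open>Actions of the monoid {0, 1}\<close>

text \<open>Since 1 acts as the identity, the only relation left to satisfy is 0 * 0 = 0, which is
  idempotence of \<open>e\<close>.\<close>

lemma idempotent_global_action:
  assumes A: "nonunital_algebra K A" and e: "e \<in> algebra_hom K A A"
    and idem: "\<And>x. x \<in> carrier A \<Longrightarrow> e (e x) = e x"
  shows "algebra_global_action zero_one_monoid K A
    (\<lambda>m x. if x \<in> carrier A then Some (if m = 0 then e x else x) else None)"
    (is "algebra_global_action _ K A ?\<beta>")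
proof -
  interpret A: nonunital_algebra K A by (rule A)
  note eD = algebra_homD[OF e]
  have dom: "dom (?\<beta> m) = carrier A" for m by (auto split: if_splits)
  have "strong_partial_action zero_one_monoid (carrier A) ?\<beta>"
    unfolding strong_partial_action_def dom
    using eD(1) idem
    by (auto simp: zero_one_monoid_def map_comp_def ran_def split: if_splits)
  moreover have "nonunital_subalgebra K A (carrier A)"
    by (rule nonunital_subalgebraI[OF A]) (auto simp: A.mult_closed)
  moreover have "(\<lambda>x. the (?\<beta> m x)) \<in> algebra_hom K (A\<lparr>carrier := carrier A\<rparr>) A" for m
    by (rule algebra_homI) (auto simp: eD A.mult_closed)
  ultimately show ?thesis
    unfolding algebra_global_action_def algebra_partial_action_def dom by blast
qed

lemma zero_one_partial_actionD:
  assumes "algebra_partial_action zero_one_monoid K X \<alpha>"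
  shows "dom (\<alpha> 0) \<subseteq> carrier X"
    and "x \<in> carrier X \<Longrightarrow> \<alpha> 1 x = Some x"
    and "\<alpha> 0 x = Some y \<Longrightarrow> \<alpha> 0 y = Some y"
    and "nonunital_subalgebra K X (dom (\<alpha> 0))"
    and "(\<lambda>x. the (\<alpha> 0 x)) \<in> algebra_hom K (X\<lparr>carrier := dom (\<alpha> 0)\<rparr>) X"
proof -
  have S: "strong_partial_action zero_one_monoid (carrier X) \<alpha>"
    using assms by (simp add: algebra_partial_action_def)
  show "dom (\<alpha> 0) \<subseteq> carrier X" and "x \<in> carrier X \<Longrightarrow> \<alpha> 1 x = Some x"
    using S by (simp_all add: strong_partial_action_def zero_one_monoid_def)
  show "nonunital_subalgebra K X (dom (\<alpha> 0))"
    and "(\<lambda>x. the (\<alpha> 0 x)) \<in> algebra_hom K (X\<lparr>carrier := dom (\<alpha> 0)\<rparr>) X"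
    using assms by (simp_all add: algebra_partial_action_def zero_one_monoid_def)
  assume xy: "\<alpha> 0 x = Some y"
  \<comment> \<open>The action axioms at m = n = 0: \<open>d\<close> says that
    \<open>\<alpha> 0\<close> maps its domain into itself, \<open>c\<close> that it is idempotent
    there.\<close>
  have d: "dom (\<alpha> 0 \<circ>\<^sub>m \<alpha> 0) = dom (\<alpha> 0)"
    and c: "\<forall>x\<in>dom (\<alpha> 0 \<circ>\<^sub>m \<alpha> 0). (\<alpha> 0 \<circ>\<^sub>m \<alpha> 0) x = \<alpha> 0 x"
    using S by (simp_all add: strong_partial_action_def zero_one_monoid_def)
  have "(\<alpha> 0 \<circ>\<^sub>m \<alpha> 0) x = \<alpha> 0 x" using c d xy by blast
  then show "\<alpha> 0 y = Some y" using xy by simp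
qed

section \<open>From a globalization to an ideal kernel\<close>

lemma globalization_imp_kernel_ideal:
  assumes X: "nonunital_algebra K X"
    and act: "algebra_partial_action zero_one_monoid K X \<alpha>"
    and glob: "globalization zero_one_monoid K X \<alpha> Y \<beta> \<iota>"
  shows "algebra_ideal K X (partial_kernel X (\<alpha> 0))"
proof -
  interpret X: nonunital_algebra K X by (rule X)
  have Y: "nonunital_algebra K Y" using glob by (simp add: globalization_def)
  interpret Y: nonunital_algebra K Y by (rule Y)
  have zero: "0 \<in> carrier zero_one_monoid" by (simp add: zero_one_monoid_def)
  have \<iota>: "\<iota> \<in> algebra_hom K X Y"
    and act\<beta>: "algebra_partial_action zero_one_monoid K Y \<beta>" and dom\<beta>: "dom (\<beta> 0) = carrier Y"
    using glob zero
    by (simp_all add: globalization_def action_morphism_def algebra_global_action_def)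
  have mor: "\<beta> 0 (\<iota> x) = Some (\<iota> y)" if "\<alpha> 0 x = Some y" for x y
  proof -
    have "\<beta> 0 (\<iota> x) = Some (\<iota> (the (\<alpha> 0 x)))"
      using glob zero domI[of "\<alpha> 0" x y] that unfolding globalization_def action_morphism_def by blast
    then show ?thesis using that by simp
  qed
  have refl: "\<alpha> 0 x = Some y"
    if "x \<in> carrier X" "y \<in> carrier X" "\<beta> 0 (\<iota> x) = Some (\<iota> y)" for x y
    using glob zero that unfolding globalization_def by blast
  note \<iota>D = algebra_homD[OF \<iota>] and \<iota>0 = algebra_hom_zero[OF X Y \<iota>]
  \<comment> \<open>As \<open>\<beta> 0\<close> is total, \<open>b\<close> is an endomorphism of all
    of \<open>Y\<close>, so its kernel is an ideal.\<close>
  define b where "b y = the (\<beta> 0 y)" for y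
  have b: "b \<in> algebra_hom K Y Y"
    using zero_one_partial_actionD(5)[OF act\<beta>] dom\<beta> by (simp add: b_def[abs_def])
  note bD = algebra_homD[OF b] and b0 = algebra_hom_zero[OF Y Y b]
  have \<beta>b: "\<beta> 0 y = Some (b y)" if "y \<in> carrier Y" for y
    using dom\<beta> that by (metis b_def domIff option.collapse)
  let ?N = "partial_kernel X (\<alpha> 0)"
  \<comment> \<open>The kernel of \<open>\<alpha> 0\<close> is thus the preimage of the kernel of
    \<open>b\<close> under \<open>\<iota>\<close>, and preimages of ideals are ideals. The converse
    inclusion is the globalization property with target zero, because \<open>\<iota>\<close> sends
    zero to zero.\<close>
  have mem: "x \<in> ?N \<longleftrightarrow> x \<in> carrier X \<and> b (\<iota> x) = \<zero>\<^bsub>Y\<^esub>" for x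
  proof
    assume x: "x \<in> ?N"
    then have "x \<in> carrier X"
      using zero_one_partial_actionD(1)[OF act] by (auto simp: partial_kernel_def)
    then show "x \<in> carrier X \<and> b (\<iota> x) = \<zero>\<^bsub>Y\<^esub>"
      using x mor[of x "\<zero>\<^bsub>X\<^esub>"] \<beta>b[OF \<iota>D(1)] \<iota>0 by (simp add: partial_kernel_def)
  next
    assume "x \<in> carrier X \<and> b (\<iota> x) = \<zero>\<^bsub>Y\<^esub>"
    then show "x \<in> ?N"
      using refl[of x "\<zero>\<^bsub>X\<^esub>"] \<beta>b[OF \<iota>D(1)[of x]] \<iota>0 by (simp add: partial_kernel_def)
  qed
  show ?thesis
    by (rule algebra_idealI[OF X])
      (auto simp: mem \<iota>D bD \<iota>0 b0 X.mult_closed Y.zero_mult)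
qed

section \<open>From an ideal kernel to a globalization\<close>

lemma kernel_ideal_imp_globalization:
  fixes X :: "('k, 'a, 'c) module_scheme"
  assumes X: "nonunital_algebra K X"
    and act: "algebra_partial_action zero_one_monoid K X \<alpha>"
    and I: "algebra_ideal K X (ran (\<alpha> 0))"
    and N: "algebra_ideal K X (partial_kernel X (\<alpha> 0))"
  shows "\<exists>(Y :: ('k, 'a set \<times> 'a set) module) \<beta> \<iota>. globalization zero_one_monoid K X \<alpha> Y \<beta> \<iota>"
proof -
  interpret X: nonunital_algebra K X by (rule X)
  define N where "N = partial_kernel X (\<alpha> 0)"
  define I where "I = ran (\<alpha> 0)"
  have NI: "algebra_ideal K X N" and II: "algebra_ideal K X I"
    using assms by (simp_all add: N_def I_def)
  note actD = zero_one_partial_actionD[OF act]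
  note homD = algebra_homD[OF actD(5), simplified]
  define Y where "Y = product_algebra (quotient_algebra X N) (quotient_algebra X I)"
  define e where "e p = (fst p, \<zero>\<^bsub>quotient_algebra X I\<^esub>)" for p :: "'a set \<times> 'a set"
  define \<beta> where
    "\<beta> m p = (if p \<in> carrier Y then Some (if m = 0 then e p else p) else None)" for m :: nat and p
  define \<iota> where "\<iota> x = (N +>\<^bsub>X\<^esub> x, I +>\<^bsub>X\<^esub> x)" for x
  have QI: "nonunital_algebra K (quotient_algebra X I)"
    by (rule X.nonunital_algebra_quotient[OF II])
  interpret QI: nonunital_algebra K "quotient_algebra X I" by (rule QI)
  have Y: "nonunital_algebra K Y"
    unfolding Y_def by (intro nonunital_algebra_product X.nonunital_algebra_quotient NI II)
  have e: "e \<in> algebra_hom K Y Y"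
    by (rule algebra_homI) (auto simp: Y_def product_algebra_def e_def QI.zero_mult)
  have global: "algebra_global_action zero_one_monoid K Y \<beta>"
    unfolding \<beta>_def[abs_def] by (rule idempotent_global_action[OF Y e]) (simp add: e_def)
  note hN = algebra_homD[OF X.coset_algebra_hom[OF NI]]
    and hI = algebra_homD[OF X.coset_algebra_hom[OF II]]
  have \<iota>: "\<iota> \<in> algebra_hom K X Y"
    by (rule algebra_homI) (simp_all add: \<iota>_def Y_def product_algebra_def hN hI)
  have \<iota>Y: "\<iota> x \<in> carrier Y" if "x \<in> carrier X" for x
    using algebra_homD(1)[OF \<iota> that] .
  have sub: "x \<ominus>\<^bsub>X\<^esub> y \<in> dom (\<alpha> 0) \<and> \<alpha> 0 (x \<ominus>\<^bsub>X\<^esub> y) = Some (the (\<alpha> 0 x) \<ominus>\<^bsub>X\<^esub> the (\<alpha> 0 y))"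
    if x: "x \<in> dom (\<alpha> 0)" and y: "y \<in> dom (\<alpha> 0)" for x y
  proof -
    have D: "submodule (dom (\<alpha> 0)) K X" using actD(4) by (simp add: nonunital_subalgebra_def)
    have xc: "x \<in> carrier X" and yc: "y \<in> carrier X" using x y actD(1) by auto
    have dm: "x \<ominus>\<^bsub>X\<^esub> y \<in> dom (\<alpha> 0)"
      using X.submoduleE(3,5)[OF D] x y by (simp add: a_minus_def)
    \<comment> \<open>Additivity of \<open>\<alpha> 0\<close> on this sum gives the image of the
      difference after cancelling.\<close>
    have "x = (x \<ominus>\<^bsub>X\<^esub> y) \<oplus>\<^bsub>X\<^esub> y"
      using xc yc by (simp add: a_minus_def X.a_assoc X.l_neg)
    then have "the (\<alpha> 0 x) = the (\<alpha> 0 (x \<ominus>\<^bsub>X\<^esub> y)) \<oplus>\<^bsub>X\<^esub> the (\<alpha> 0 y)"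
      using homD(2)[OF dm y] by simp
    then have "the (\<alpha> 0 (x \<ominus>\<^bsub>X\<^esub> y)) = the (\<alpha> 0 x) \<ominus>\<^bsub>X\<^esub> the (\<alpha> 0 y)"
      using homD(1)[OF dm] homD(1)[OF y] by (simp add: a_minus_def X.a_assoc X.r_neg)
    then show ?thesis using dm by auto
  qed
  have \<alpha>0_iff: "\<alpha> 0 x = Some y \<longleftrightarrow> y \<in> I \<and> x \<ominus>\<^bsub>X\<^esub> y \<in> N"
    if x: "x \<in> carrier X" and y: "y \<in> carrier X" for x y
  proof
    assume xy: "\<alpha> 0 x = Some y"
    then have yy: "\<alpha> 0 y = Some y" by (rule actD(3))
    \<comment> \<open>By idempotence x and y have the same image y.\<close>
    then have "\<alpha> 0 (x \<ominus>\<^bsub>X\<^esub> y) = Some (y \<ominus>\<^bsub>X\<^esub> y)" using sub[of x y] xy by auto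
    then show "y \<in> I \<and> x \<ominus>\<^bsub>X\<^esub> y \<in> N"
      using xy y by (auto simp: I_def N_def ran_def partial_kernel_def a_minus_def X.r_neg)
  next
    assume a: "y \<in> I \<and> x \<ominus>\<^bsub>X\<^esub> y \<in> N"
    then have yy: "\<alpha> 0 y = Some y" using actD(3) by (auto simp: I_def ran_def)
    have d: "\<alpha> 0 (x \<ominus>\<^bsub>X\<^esub> y) = Some \<zero>\<^bsub>X\<^esub>" using a by (simp add: N_def partial_kernel_def)
    have D: "submodule (dom (\<alpha> 0)) K X" using actD(4) by (simp add: nonunital_subalgebra_def)
    \<comment> \<open>x is a sum of two elements of the domain, whose images are zero and y.\<close>
    have "(x \<ominus>\<^bsub>X\<^esub> y) \<oplus>\<^bsub>X\<^esub> y \<in> dom (\<alpha> 0)"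
      using X.submoduleE(5)[OF D] d yy by blast
    moreover have "(x \<ominus>\<^bsub>X\<^esub> y) \<oplus>\<^bsub>X\<^esub> y = x"
      using x y by (simp add: a_minus_def X.a_assoc X.l_neg)
    moreover have "the (\<alpha> 0 ((x \<ominus>\<^bsub>X\<^esub> y) \<oplus>\<^bsub>X\<^esub> y)) = y"
      using homD(2)[of "x \<ominus>\<^bsub>X\<^esub> y" y] d yy y by auto
    ultimately show "\<alpha> 0 x = Some y" by auto
  qed
  \<comment> \<open>At the element 0, the direction from right to left gives the morphism condition
    and the other one the globalization property.\<close>
  have \<beta>0: "\<beta> 0 (\<iota> x) = Some (\<iota> y) \<longleftrightarrow> \<alpha> 0 x = Some y"
    if x: "x \<in> carrier X" and y: "y \<in> carrier X" for x y
    using \<iota>Y[OF x] X.coset_eq_iff[OF NI x y] X.coset_eq_zero_iff[OF II y] \<alpha>0_iff[OF x y]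
    by (auto simp: \<beta>_def \<iota>_def e_def)
  \<comment> \<open>The globalization property at 1 amounts to injectivity of
    \<open>\<iota>\<close>. It holds because \<open>N\<close> and \<open>I\<close> meet only in
    zero: \<open>\<alpha> 0\<close> fixes the elements of \<open>I\<close> and kills those of
    \<open>N\<close>.\<close>
  have inj: "x = y" if x: "x \<in> carrier X" and y: "y \<in> carrier X" and eq: "\<iota> x = \<iota> y" for x y
  proof -
    have m: "x \<ominus>\<^bsub>X\<^esub> y \<in> N" "x \<ominus>\<^bsub>X\<^esub> y \<in> I"
      using eq X.coset_eq_iff[OF NI x y] X.coset_eq_iff[OF II x y] by (auto simp: \<iota>_def)
    then have "\<alpha> 0 (x \<ominus>\<^bsub>X\<^esub> y) = Some (x \<ominus>\<^bsub>X\<^esub> y)" using actD(3) by (auto simp: I_def ran_def)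
    then have "x \<ominus>\<^bsub>X\<^esub> y = \<zero>\<^bsub>X\<^esub>" using m(1) by (simp add: N_def partial_kernel_def)
    moreover have "x = (x \<ominus>\<^bsub>X\<^esub> y) \<oplus>\<^bsub>X\<^esub> y"
      using x y by (simp add: a_minus_def X.a_assoc X.l_neg)
    ultimately show ?thesis using y by simp
  qed
  \<comment> \<open>Idempotence puts y into the domain of \<open>\<alpha> 0\<close>, hence into the
    carrier.\<close>
  have \<alpha>c: "x \<in> carrier X \<and> y \<in> carrier X" if "\<alpha> 0 x = Some y" for x y
    using that actD(1) actD(3)[OF that] by blast
  have mor: "action_morphism zero_one_monoid K X \<alpha> Y \<beta> \<iota>"
    unfolding action_morphism_def
  proof (intro conjI \<iota> ballI)
    fix m x assume m: "m \<in> carrier zero_one_monoid" and x: "x \<in> dom (\<alpha> m)"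
    then consider "m = 0" | "m = 1" by (auto simp: zero_one_monoid_def)
    then show "\<beta> m (\<iota> x) = Some (\<iota> (the (\<alpha> m x)))"
    proof cases
      case 1
      then show ?thesis using x \<beta>0 \<alpha>c by fastforce
    next
      case 2
      have "x \<in> carrier X"
        using act m x by (auto simp: algebra_partial_action_def strong_partial_action_def)
      then show ?thesis using 2 actD(2)[of x] \<iota>Y by (simp add: \<beta>_def)
    qed
  qed
  have "x \<in> dom (\<alpha> m) \<and> \<alpha> m x = Some y"
    if m: "m \<in> carrier zero_one_monoid" and x: "x \<in> carrier X" and y: "y \<in> carrier X"
      and eq: "\<beta> m (\<iota> x) = Some (\<iota> y)" for m x y
  proof -
    consider "m = 0" | "m = 1" using m by (auto simp: zero_one_monoid_def)
    then show ?thesis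
    proof cases
      case 1
      then show ?thesis using \<beta>0[OF x y] eq by auto
    next
      case 2
      then have "x = y" using eq inj[OF x y] \<iota>Y[OF x] by (simp add: \<beta>_def)
      then show ?thesis using 2 actD(2)[OF x] by auto
    qed
  qed
  then have "globalization zero_one_monoid K X \<alpha> Y \<beta> \<iota>"
    using Y global mor by (simp add: globalization_def)
  then show ?thesis by blast
qed

theorem theorem4p4:
  fixes K :: "('k, 'r) ring_scheme"
    and X :: "('k, 'a, 'c) module_scheme"
    and \<alpha> :: "nat \<Rightarrow> 'a \<rightharpoonup> 'a"
  assumes "field K"
    and "nonunital_algebra K X"
    and "algebra_partial_action zero_one_monoid K X \<alpha>"
    and "algebra_ideal K X (dom (\<alpha> 0))"
    and "algebra_ideal K X (ran (\<alpha> 0))"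
  shows "globalizable zero_one_monoid K X \<alpha> \<longleftrightarrow> algebra_ideal K X (partial_kernel X (\<alpha> 0))"
proof
  assume "globalizable zero_one_monoid K X \<alpha>"
  then show "algebra_ideal K X (partial_kernel X (\<alpha> 0))"
    unfolding globalizable_def using globalization_imp_kernel_ideal[OF assms(2,3)] by blast
next
  assume "algebra_ideal K X (partial_kernel X (\<alpha> 0))"
  then obtain Y :: "('k, 'a set \<times> 'a set) module" and \<beta> \<iota>
    where "globalization zero_one_monoid K X \<alpha> Y \<beta> \<iota>"
    using kernel_ideal_imp_globalization[OF assms(2,3,5)] by blast
  \<comment> \<open>The globalization found lives on pairs of cosets; it is transferred to the
    carrier type that \<open>globalizable\<close> fixes.\<close>
  then show "globalizable zero_one_monoid K X \<alpha>"
    by (rule globalization_imp_globalizable[OF zero_one_monoid assms(2,3)])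
qed

end
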